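(* Let $(n,w)$ be an $(n,d,\varepsilon)$-regular instance of TSP. Let $M^*$ be an optimal matching of $K_n$ of minimum weight, and let $H^*$ be any Hamilton cycle of $K_n$ with $$w(H^* )\le\Big(1-\frac1{n-2}\Big)w(M^* )+\frac1{n-2}w(K_n)+\rho(n),$$ where $\rho(n)=1$ if $n$ is odd and $0$ if $n$ is even. Then for a uniformly random Hamilton cycle $H$ of $K_n$, $\mathbb{P}(w(H)\le w(H^* ))\le 2n^{-\varepsilon}$; in particular the algorithm outputting such $H^*$ has domination ratio at least $1-2n^{-\varepsilon}$ for $(n,w)$.
   Context: $K_n=(V_n,E_n)$ is the complete graph on $n$ vertices; $w(G)=\sum_{e\in E(G)}w(e)$; a $\{0,1\}$-instance has $w:E_n\to\{0,1\}$. An optimal matching of $K_n$ is any set of $\lfloor n/2\rfloor$ pairwise disjoint edges. For $d\in[0,1]$, $\varepsilon>0$ and integer $n>\max\{6,\exp(\varepsilon^{-1})\}$, a $\{0,1\}$-instance $(n,w)$ is $(n,d,\varepsilon)$-regular if (i) $w(K_n)=d\binom n2$, and (ii) there is an optimal matching $M$ of $K_n$ with either $w(M)\le\frac12dn-m_\varepsilon(n,d)$ or $w(M)\le\frac12dn-m_\varepsilon(n,1-d)$, where $m_\varepsilon(n,d):=40(\varepsilon+\varepsilon^{1/2})\log n+40\varepsilon^{1/2}d^{1/4}\sqrt{n\log n}$. *)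

theory Defs
  imports "HOL-Analysis.Analysis"
begin

definition Kn_edges :: "nat \<Rightarrow> nat set set" where
  "Kn_edges n = {e. \<exists>u v. u < n \<and> v < n \<and> u \<noteq> v \<and> e = {u, v}}"

definition wt :: "(nat set \<Rightarrow> real) \<Rightarrow> nat set set \<Rightarrow> real" where
  "wt w G = (\<Sum>e\<in>G. w e)"

definition zero_one_instance :: "nat \<Rightarrow> (nat set \<Rightarrow> real) \<Rightarrow> bool" where
  "zero_one_instance n w \<longleftrightarrow> (\<forall>e\<in>Kn_edges n. w e = 0 \<or> w e = 1)"

definition optimal_matching :: "nat \<Rightarrow> nat set set \<Rightarrow> bool" where
  "optimal_matching n M \<longleftrightarrow> M \<subseteq> Kn_edges n \<and> card M = n div 2 \<and>
     (\<forall>e\<in>M. \<forall>f\<in>M. e \<noteq> f \<longrightarrow> e \<inter> f = {})"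

definition ham_cycles :: "nat \<Rightarrow> nat set set set" where
  "ham_cycles n = {H. \<exists>vs. distinct vs \<and> set vs = {0..<n} \<and>
       H = {{vs ! i, vs ! ((i + 1) mod n)} | i. i < n}}"

definition m_eps :: "real \<Rightarrow> nat \<Rightarrow> real \<Rightarrow> real" where
  "m_eps \<epsilon> n d = 40 * (\<epsilon> + sqrt \<epsilon>) * ln (real n)
      + 40 * sqrt \<epsilon> * d powr (1/4) * sqrt (real n * ln (real n))"

definition regular_instance :: "nat \<Rightarrow> (nat set \<Rightarrow> real) \<Rightarrow> real \<Rightarrow> real \<Rightarrow> bool" where
  "regular_instance n w d \<epsilon> \<longleftrightarrow>
     0 \<le> d \<and> d \<le> 1 \<and> \<epsilon> > 0 \<and> real n > max 6 (exp (1 / \<epsilon>)) \<and>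
     zero_one_instance n w \<and>
     wt w (Kn_edges n) = d * real (n choose 2) \<and>
     (\<exists>M. optimal_matching n M \<and>
        (wt w M \<le> d * real n / 2 - m_eps \<epsilon> n d \<or>
         wt w M \<le> d * real n / 2 - m_eps \<epsilon> n (1 - d)))"

end

theory Submission
  imports Defs "HOL-Combinatorics.Permutations"
begin

text \<open>
  Chatterjee's method of exchangeable pairs, applied to the 2-opt move that reverses a segment of a
  Hamilton cycle. Summed over all ordered pairs of distinct positions, a 2-opt move removes
  \<open>2(n-1) w(H)\<close> and adds \<open>4 w(K\<^sub>n)\<close>, so the total decrease is exactly
  \<open>2(n-1)(w(H) - dn)\<close>; as each move changes \<open>w(H)\<close> by at most 2, the sum of squared changes
  is at most \<open>4(n-1)(w(H) + dn)\<close>. These two facts give a differential inequality for the moment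
  generating function of \<open>w(H) - dn\<close>, hence a Bernstein-type tail bound. The hypotheses force
  \<open>w(H\<^sup>*) \<le> dn - t\<close> with \<open>t = (1 - 1/(n-2)) m\<^sub>\<epsilon> - 1\<close>, far beyond the
  standard deviation \<open>O(sqrt (dn))\<close>. If the hypothesis is in terms of \<open>1 - d\<close>, the weights
  \<open>1 - w\<close> are used instead.
\<close>

section \<open>Concentration from a family of involutions\<close>

text \<open>The inequality \<open>1 + z \<le> exp z\<close> bounds the increment by its slope at the
  larger point, and that slope is at most \<theta> times the sum of both exponentials. Symmetry in
  \<open>x\<close> and \<open>y\<close> settles the other order; the symmetric form is what
  exchangeability requires.\<close>

lemma exp_diff_mult_le:
  fixes x y \<theta> :: real
  assumes "0 \<le> \<theta>"
  shows "(x - y) * (exp (\<theta> * x) - exp (\<theta> * y)) \<le> \<theta> * (x - y)\<^sup>2 * (exp (\<theta> * x) + exp (\<theta> * y))"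
proof -
  have *: "exp (\<theta> * u) - exp (\<theta> * v) \<le> \<theta> * (u - v) * (exp (\<theta> * u) + exp (\<theta> * v))" if "v \<le> u" for u v :: real
  proof -
    have "exp (\<theta> * u) * (1 + \<theta> * (v - u)) \<le> exp (\<theta> * u) * exp (\<theta> * (v - u))"
      by (intro mult_left_mono exp_ge_add_one_self) simp
    also have "\<dots> = exp (\<theta> * v)"
      by (simp flip: exp_add add: algebra_simps)
    finally have "exp (\<theta> * u) - exp (\<theta> * v) \<le> \<theta> * (u - v) * exp (\<theta> * u)"
      by (simp add: algebra_simps)
    also have "\<dots> \<le> \<theta> * (u - v) * (exp (\<theta> * u) + exp (\<theta> * v))"
      using that assms by (intro mult_left_mono) auto
    finally show ?thesis .
  qed
  show ?thesis
  proof (cases "y \<le> x")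
    case True
    then have "(x - y) * (exp (\<theta> * x) - exp (\<theta> * y)) \<le> (x - y) * (\<theta> * (x - y) * (exp (\<theta> * x) + exp (\<theta> * y)))"
      by (intro mult_left_mono *) auto
    then show ?thesis by (simp add: power2_eq_square algebra_simps)
  next
    case False
    then have "(y - x) * (exp (\<theta> * y) - exp (\<theta> * x)) \<le> (y - x) * (\<theta> * (y - x) * (exp (\<theta> * y) + exp (\<theta> * x)))"
      by (intro mult_left_mono *) auto
    then show ?thesis by (simp add: power2_eq_square algebra_simps)
  qed
qed

text \<open>For uniform \<open>x\<close> and \<open>p\<close> the pair \<open>(x, T p x)\<close> is
  exchangeable, as each \<open>T p\<close> is an involution of \<open>X\<close>.
  \<open>drift\<close> is the linear regression condition and \<open>quad\<close> a self-bounding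
  variance condition, both as sums over \<open>P\<close> instead of averages. The values
  \<open>s = 1\<close> and \<open>s = -1\<close> cover the two tails of one statistic.\<close>

locale involution_family =
  fixes X :: "'a set" and P :: "'p set" and T :: "'p \<Rightarrow> 'a \<Rightarrow> 'a"
    and f :: "'a \<Rightarrow> real" and c s K :: real
  assumes fin_X: "finite X"
    and T_in: "\<And>p x. p \<in> P \<Longrightarrow> x \<in> X \<Longrightarrow> T p x \<in> X"
    and T_T: "\<And>p x. p \<in> P \<Longrightarrow> x \<in> X \<Longrightarrow> T p (T p x) = x"
    and c_pos: "0 < c" and s_le: "s \<le> 1" and K_nonneg: "0 \<le> K"
    and drift: "\<And>x. x \<in> X \<Longrightarrow> (\<Sum>p\<in>P. f x - f (T p x)) = c * f x"
    and quad: "\<And>x. x \<in> X \<Longrightarrow> (\<Sum>p\<in>P. (f x - f (T p x))\<^sup>2) \<le> 2 * c * (s * f x + K)"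
begin

definition mgf :: "real \<Rightarrow> real" where
  "mgf \<theta> = (\<Sum>x\<in>X. exp (\<theta> * f x))"

definition mgf' :: "real \<Rightarrow> real" where
  "mgf' \<theta> = (\<Sum>x\<in>X. f x * exp (\<theta> * f x))"

lemma mgf_deriv: "(mgf has_real_derivative mgf' \<theta>) (at \<theta>)"
  unfolding mgf_def mgf'_def by (auto intro!: derivative_eq_intros sum.cong simp: mult.commute)

lemma mgf_nonneg: "0 \<le> mgf \<theta>"
  unfolding mgf_def by (intro sum_nonneg) auto

lemma sum_T:
  fixes h :: "'a \<Rightarrow> 'a \<Rightarrow> real"
  assumes "p \<in> P"
  shows "(\<Sum>x\<in>X. h (T p x) x) = (\<Sum>x\<in>X. h x (T p x))"
  by (rule sum.reindex_bij_witness[of _ "T p" "T p"]) (use assms T_in T_T in auto)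

text \<open>\<open>drift\<close> expresses \<open>c * mgf' \<theta>\<close> through the increments
  of \<open>f\<close>, symmetrisation brings in their squares, and \<open>quad\<close> makes these
  linear in \<open>f\<close> again. The outcome is a differential inequality for
  \<open>mgf\<close>.\<close>

lemma mgf'_le:
  assumes "0 \<le> \<theta>"
  shows "mgf' \<theta> \<le> 2 * \<theta> * (s * mgf' \<theta> + K * mgf \<theta>)"
proof -
  define e where "e x = exp (\<theta> * f x)" for x
  have p: "(\<Sum>x\<in>X. (f x - f (T p x)) * e x) \<le> \<theta> * (\<Sum>x\<in>X. (f x - f (T p x))\<^sup>2 * e x)" if "p \<in> P" for p
  proof -
    have 1: "(\<Sum>x\<in>X. (f (T p x) - f x) * e (T p x)) = (\<Sum>x\<in>X. (f x - f (T p x)) * e x)"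
      using sum_T[OF that, of "\<lambda>x y. (f x - f y) * e x"] .
    have 2: "(\<Sum>x\<in>X. (f (T p x) - f x)\<^sup>2 * e (T p x)) = (\<Sum>x\<in>X. (f x - f (T p x))\<^sup>2 * e x)"
      using sum_T[OF that, of "\<lambda>x y. (f x - f y)\<^sup>2 * e x"] .
    \<comment> \<open>Adding the sum to its image under the involution replaces the weight
      \<open>e x\<close> by the difference \<open>e x - e (T p x)\<close>.\<close>
    have "2 * (\<Sum>x\<in>X. (f x - f (T p x)) * e x)
        = (\<Sum>x\<in>X. (f x - f (T p x)) * e x) + (\<Sum>x\<in>X. (f (T p x) - f x) * e (T p x))"
      unfolding 1 by simp
    also have "\<dots> = (\<Sum>x\<in>X. (f x - f (T p x)) * (e x - e (T p x)))"
      by (simp flip: sum.distrib add: algebra_simps)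
    also have "\<dots> \<le> (\<Sum>x\<in>X. \<theta> * (f x - f (T p x))\<^sup>2 * (e x + e (T p x)))"
      unfolding e_def by (intro sum_mono exp_diff_mult_le assms)
    also have "\<dots> = \<theta> * ((\<Sum>x\<in>X. (f x - f (T p x))\<^sup>2 * e x) + (\<Sum>x\<in>X. (f (T p x) - f x)\<^sup>2 * e (T p x)))"
      by (simp flip: sum.distrib add: sum_distrib_left algebra_simps power2_commute)
    also have "\<dots> = 2 * (\<theta> * (\<Sum>x\<in>X. (f x - f (T p x))\<^sup>2 * e x))"
      unfolding 2 by simp
    finally show ?thesis by simp
  qed
  have "c * mgf' \<theta> = (\<Sum>x\<in>X. (\<Sum>p\<in>P. f x - f (T p x)) * e x)"
    unfolding mgf'_def sum_distrib_left e_def by (intro sum.cong) (auto simp: drift)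
  also have "\<dots> = (\<Sum>p\<in>P. \<Sum>x\<in>X. (f x - f (T p x)) * e x)"
    unfolding sum_distrib_right by (rule sum.swap)
  also have "\<dots> \<le> (\<Sum>p\<in>P. \<theta> * (\<Sum>x\<in>X. (f x - f (T p x))\<^sup>2 * e x))"
    by (intro sum_mono p)
  also have "\<dots> = \<theta> * (\<Sum>x\<in>X. (\<Sum>p\<in>P. (f x - f (T p x))\<^sup>2) * e x)"
    unfolding sum_distrib_right sum_distrib_left by (rule sum.swap)
  also have "\<dots> \<le> \<theta> * (\<Sum>x\<in>X. (2 * c * (s * f x + K)) * e x)"
    by (intro mult_left_mono sum_mono mult_right_mono quad assms) (auto simp: e_def)
  also have "\<dots> = c * (2 * \<theta> * (s * mgf' \<theta> + K * mgf \<theta>))"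
    unfolding mgf_def mgf'_def e_def by (simp add: sum_distrib_left sum.distrib algebra_simps)
  finally show ?thesis using c_pos by simp
qed

text \<open>For \<theta> up to 1/4 the factor \<open>1 - 2 * \<theta> * s\<close> is at least 1/2,
  so a positive derivative term on the right of \<open>mgf'_le\<close> can be absorbed on the
  left.\<close>

lemma mgf'_le_mgf:
  assumes "0 \<le> \<theta>" "\<theta> \<le> 1/4"
  shows "mgf' \<theta> \<le> 4 * \<theta> * K * mgf \<theta>"
proof (cases "mgf' \<theta> \<le> 0")
  case True
  also have "0 \<le> 4 * \<theta> * K * mgf \<theta>"
    using assms K_nonneg mgf_nonneg by simp
  finally show ?thesis .
next
  case False
  have "\<theta> * s \<le> \<theta> * 1" using assms s_le by (intro mult_left_mono) auto
  then have "mgf' \<theta> * (1/2) \<le> mgf' \<theta> * (1 - 2 * (\<theta> * s))"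
    using False assms by (intro mult_left_mono) auto
  also have "\<dots> \<le> 2 * \<theta> * K * mgf \<theta>"
    using mgf'_le[OF assms(1)] by (simp add: algebra_simps)
  finally show ?thesis by simp
qed

text \<open>Gronwall argument: \<open>4 * \<theta> * K\<close> integrates to
  \<open>2 * K * \<theta>\<^sup>2\<close>, so \<open>mgf\<close> divided by the exponential of the
  latter is nonincreasing, with value \<open>card X\<close> at 0.\<close>

lemma mgf_bound:
  assumes "0 \<le> \<theta>" "\<theta> \<le> 1/4"
  shows "mgf \<theta> \<le> real (card X) * exp (2 * K * \<theta>\<^sup>2)"
proof -
  define g where "g \<theta> = mgf \<theta> * exp (- (2 * K * \<theta>\<^sup>2))" for \<theta>
  have "g \<theta> \<le> g 0"
  proof (rule DERIV_nonpos_imp_nonincreasing[OF assms(1)])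
    fix x assume x: "0 \<le> x" "x \<le> \<theta>"
    have "(g has_real_derivative (mgf' x - 4 * x * K * mgf x) * exp (- (2 * K * x\<^sup>2))) (at x)"
      unfolding g_def by (auto intro!: derivative_eq_intros mgf_deriv simp: algebra_simps)
    moreover have "(mgf' x - 4 * x * K * mgf x) * exp (- (2 * K * x\<^sup>2)) \<le> 0"
      using mgf'_le_mgf[of x] x assms by (intro mult_nonpos_nonneg) auto
    ultimately show "\<exists>y. (g has_real_derivative y) (at x) \<and> y \<le> 0" by blast
  qed
  also have "g 0 = real (card X)" by (simp add: g_def mgf_def)
  finally show ?thesis by (simp add: g_def exp_minus field_simps)
qed

lemma tail_bound:
  assumes "0 < t" "8 * L \<le> t" "8 * K * L \<le> t\<^sup>2"
  shows "real (card {x \<in> X. t \<le> f x}) \<le> real (card X) * exp (- L)"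
proof -
  \<comment> \<open>The Chernoff exponent is maximal at \<open>t / (4 * K)\<close>, with value
    \<open>t\<^sup>2 / (8 * K)\<close>. This point is admissible when \<open>t \<le> K\<close>;
    otherwise the endpoint 1/4 gives \<open>t / 4 - K / 8\<close>, which exceeds
    \<open>t / 8\<close>.\<close>
  obtain \<theta> where th: "0 \<le> \<theta>" "\<theta> \<le> 1/4" "L \<le> \<theta> * t - 2 * K * \<theta>\<^sup>2"
  proof (cases "t \<le> K")
    case True
    then have K: "0 < K" using assms by simp
    have "L \<le> t\<^sup>2 / (8 * K)" using assms K by (simp add: field_simps)
    also have "\<dots> = t / (4 * K) * t - 2 * K * (t / (4 * K))\<^sup>2"
      using K by (simp add: field_simps power2_eq_square)
    finally show ?thesis using True K assms by (intro that[of "t / (4 * K)"]) (auto simp: field_simps)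
  next
    case False
    then show ?thesis using assms by (intro that[of "1/4"]) (auto simp: power2_eq_square)
  qed
  have "real (card {x \<in> X. t \<le> f x}) * exp (\<theta> * t) = (\<Sum>x\<in>{x \<in> X. t \<le> f x}. exp (\<theta> * t))"
    by simp
  also have "\<dots> \<le> (\<Sum>x\<in>{x \<in> X. t \<le> f x}. exp (\<theta> * f x))"
    using th by (intro sum_mono) (auto intro: mult_left_mono)
  also have "\<dots> \<le> mgf \<theta>"
    unfolding mgf_def by (intro sum_mono2) (auto simp: fin_X)
  also have "\<dots> \<le> real (card X) * exp (2 * K * \<theta>\<^sup>2)"
    using th by (intro mgf_bound)
  finally have "real (card {x \<in> X. t \<le> f x}) \<le> real (card X) * exp (2 * K * \<theta>\<^sup>2 - \<theta> * t)"
    by (simp add: exp_diff field_simps)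
  also have "\<dots> \<le> real (card X) * exp (- L)"
    using th by (intro mult_left_mono) auto
  finally show ?thesis .
qed

end

section \<open>Hamilton cycles as permutations\<close>

text \<open>Position \<open>i\<close> of the tour holds vertex \<open>\<sigma> i\<close>.
  Composition on the left relabels vertices, composition on the right rearranges positions.\<close>

definition cyc :: "nat \<Rightarrow> (nat \<Rightarrow> nat) \<Rightarrow> nat set set" where
  "cyc n \<sigma> = (\<lambda>i. {\<sigma> i, \<sigma> ((i + 1) mod n)}) ` {..<n}"

lemma ham_cycles_eq: "ham_cycles n = cyc n ` {\<sigma>. \<sigma> permutes {..<n}}"
proof (intro set_eqI iffI)
  fix H assume "H \<in> ham_cycles n"
  then obtain vs where vs: "distinct vs" "set vs = {0..<n}"
    and H: "H = {{vs ! i, vs ! ((i + 1) mod n)} | i. i < n}"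
    unfolding ham_cycles_def by blast
  have len: "length vs = n" using distinct_card[OF vs(1)] vs(2) by simp
  \<comment> \<open>The default value \<open>i\<close> is forced: \<open>permutes\<close> demands
    the identity outside the set.\<close>
  define \<sigma> where "\<sigma> i = (if i < n then vs ! i else i)" for i
  have "bij_betw ((!) vs) {..<n} {..<n}"
    using bij_betw_nth[OF vs(1) refl refl] by (simp only: vs(2) len atLeast0LessThan)
  moreover have "bij_betw \<sigma> {..<n} {..<n} = bij_betw ((!) vs) {..<n} {..<n}"
    by (rule bij_betw_cong) (simp add: \<sigma>_def)
  ultimately have "bij_betw \<sigma> {..<n} {..<n}" by simp
  then have "\<sigma> permutes {..<n}"
    by (rule bij_imp_permutes) (auto simp: \<sigma>_def)
  moreover have "H = cyc n \<sigma>"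
  proof (cases "n = 0")
    case False
    then show ?thesis unfolding H cyc_def \<sigma>_def by (auto simp: image_def)
  qed (auto simp: H cyc_def)
  ultimately show "H \<in> cyc n ` {\<sigma>. \<sigma> permutes {..<n}}" by blast
next
  fix H assume "H \<in> cyc n ` {\<sigma>. \<sigma> permutes {..<n}}"
  then obtain \<sigma> where s: "\<sigma> permutes {..<n}" and H: "H = cyc n \<sigma>" by blast
  have "distinct (map \<sigma> [0..<n])" "set (map \<sigma> [0..<n]) = {0..<n}"
    using permutes_inj_on[OF s] permutes_image[OF s] by (auto simp: distinct_map atLeast0LessThan)
  moreover have "H = {{map \<sigma> [0..<n] ! i, map \<sigma> [0..<n] ! ((i + 1) mod n)} | i. i < n}"
    unfolding H cyc_def by (force simp: image_def)
  ultimately show "H \<in> ham_cycles n" unfolding ham_cycles_def by blast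
qed

lemma cyc_comp: "cyc n (\<pi> \<circ> \<sigma>) = image \<pi> ` cyc n \<sigma>"
  by (simp add: cyc_def image_image)

text \<open>Relabelling by \<open>\<tau> \<circ> inv \<sigma>\<close> injects the arrangements of
  the first cycle into those of the second. Exchanging the roles shows that all fibres of
  \<open>cyc n\<close> are equally large.\<close>

lemma card_cyc_fibre_le:
  assumes a: "\<sigma> permutes {..<n}" and b: "\<tau> permutes {..<n}"
  shows "card {\<rho>. \<rho> permutes {..<n} \<and> cyc n \<rho> = cyc n \<sigma>} \<le> card {\<rho>. \<rho> permutes {..<n} \<and> cyc n \<rho> = cyc n \<tau>}"
proof (rule card_inj_on_le)
  let ?\<pi> = "\<tau> \<circ> inv \<sigma>"
  have p: "?\<pi> permutes {..<n}" using a b by (intro permutes_compose permutes_inv)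
  have eq: "?\<pi> \<circ> \<sigma> = \<tau>" using permutes_inv_o[OF a] by (simp add: o_assoc[symmetric])
  show "inj_on (\<lambda>\<rho>. ?\<pi> \<circ> \<rho>) {\<rho>. \<rho> permutes {..<n} \<and> cyc n \<rho> = cyc n \<sigma>}"
    using permutes_inj[OF p] by (intro inj_onI) (simp only: inj_eq fun.inj_map)
  show "(\<lambda>\<rho>. ?\<pi> \<circ> \<rho>) ` {\<rho>. \<rho> permutes {..<n} \<and> cyc n \<rho> = cyc n \<sigma>} \<subseteq> {\<rho>. \<rho> permutes {..<n} \<and> cyc n \<rho> = cyc n \<tau>}"
  proof (safe)
    fix \<rho> assume r: "\<rho> permutes {..<n}" "cyc n \<rho> = cyc n \<sigma>"
    show "?\<pi> \<circ> \<rho> permutes {..<n}" by (rule permutes_compose[OF r(1) p])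
    have "cyc n (?\<pi> \<circ> \<rho>) = cyc n (?\<pi> \<circ> \<sigma>)" unfolding cyc_comp r ..
    then show "x \<in> cyc n \<tau>" if "x \<in> cyc n (?\<pi> \<circ> \<rho>)" for x using that eq by simp
    show "x \<in> cyc n (?\<pi> \<circ> \<rho>)" if "x \<in> cyc n \<tau>" for x
      using that eq \<open>cyc n (?\<pi> \<circ> \<rho>) = cyc n (?\<pi> \<circ> \<sigma>)\<close> by simp
  qed
  show "finite {\<rho>. \<rho> permutes {..<n} \<and> cyc n \<rho> = cyc n \<tau>}"
    by (rule finite_subset[OF _ finite_permutations[of "{..<n}"]]) auto
qed

text \<open>Since every fibre of \<open>cyc n\<close> has the same positive size \<open>k\<close>, a
  uniform permutation induces a uniform Hamilton cycle, and \<open>k\<close> cancels.\<close>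

lemma ham_cycles_ratio_eq:
  "real (card {H \<in> ham_cycles n. Q H}) / real (card (ham_cycles n))
     = real (card {\<sigma>. \<sigma> permutes {..<n} \<and> Q (cyc n \<sigma>)}) / real (card {\<sigma>. \<sigma> permutes {..<n}})"
proof -
  let ?X = "{\<sigma>. \<sigma> permutes {..<n}}"
  define k where "k = card {\<rho>. \<rho> permutes {..<n} \<and> cyc n \<rho> = cyc n id}"
  have fin: "finite ?X" by (simp add: finite_permutations)
  have k: "card {\<rho>. \<rho> permutes {..<n} \<and> cyc n \<rho> = H} = k" if H: "H \<in> ham_cycles n" for H
  proof -
    obtain \<sigma> where s: "\<sigma> permutes {..<n}" "H = cyc n \<sigma>" using H by (auto simp: ham_cycles_eq)
    show ?thesis unfolding k_def s(2)
      by (intro antisym card_cyc_fibre_le s permutes_id)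
  qed
  have count: "card {\<sigma>. \<sigma> permutes {..<n} \<and> R (cyc n \<sigma>)} = card {H \<in> ham_cycles n. R H} * k" for R
  proof -
    have "{\<sigma>. \<sigma> permutes {..<n} \<and> R (cyc n \<sigma>)}
        = (\<Union>H\<in>{H \<in> ham_cycles n. R H}. {\<rho>. \<rho> permutes {..<n} \<and> cyc n \<rho> = H})"
      by (auto simp: ham_cycles_eq)
    also have "card \<dots> = (\<Sum>H\<in>{H \<in> ham_cycles n. R H}. card {\<rho>. \<rho> permutes {..<n} \<and> cyc n \<rho> = H})"
      by (rule card_UN_disjoint)
        (auto simp: ham_cycles_eq fin intro: finite_subset[OF _ fin])
    also have "\<dots> = card {H \<in> ham_cycles n. R H} * k" by (simp add: k)
    finally show ?thesis .
  qed
  have "k > 0" unfolding k_def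
    by (subst card_gt_0_iff) (auto intro: finite_subset[OF _ fin] permutes_id)
  then show ?thesis using count[of Q] count[of "\<lambda>_. True"] by simp
qed

definition cyc_weight :: "nat \<Rightarrow> (nat set \<Rightarrow> real) \<Rightarrow> (nat \<Rightarrow> nat) \<Rightarrow> real" where
  "cyc_weight n w \<sigma> = (\<Sum>i<n. w {\<sigma> i, \<sigma> ((i + 1) mod n)})"

lemma succ_mod_eq:
  fixes k n :: nat
  assumes "k < n"
  shows "(k + 1) mod n = (if k + 1 = n then 0 else k + 1)"
  using assms by auto

text \<open>Distinct positions could carry the same edge only if each were the cyclic successor of
  the other, which is impossible for at least three positions.\<close>

lemma cyc_edge_inj:
  fixes n :: nat
  assumes "\<sigma> permutes {..<n}" "3 \<le> n"
  shows "inj_on (\<lambda>i. {\<sigma> i, \<sigma> ((i + 1) mod n)}) {..<n}"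
proof (rule inj_onI)
  fix i j :: nat assume ij: "i \<in> {..<n}" "j \<in> {..<n}"
    and "{\<sigma> i, \<sigma> ((i + 1) mod n)} = {\<sigma> j, \<sigma> ((j + 1) mod n)}"
  then have "{i, (i + 1) mod n} = {j, (j + 1) mod n}"
    using permutes_inj[OF assms(1)] by (auto simp: doubleton_eq_iff dest: injD)
  then show "i = j" using ij assms(2) succ_mod_eq[of i n] succ_mod_eq[of j n]
    by (auto simp: doubleton_eq_iff simp del: mod_less split: if_splits)
qed

lemma wt_cyc:
  assumes "\<sigma> permutes {..<n}" "3 \<le> n"
  shows "wt w (cyc n \<sigma>) = cyc_weight n w \<sigma>"
  unfolding wt_def cyc_def cyc_weight_def using sum.reindex[OF cyc_edge_inj[OF assms]] by simp

section \<open>Sums over ordered pairs of distinct positions or vertices\<close>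

definition off_diag :: "nat \<Rightarrow> (nat \<times> nat) set" where
  "off_diag n = {(i, j). i < n \<and> j < n \<and> i \<noteq> j}"

lemma sum_off_diag_edges: "(\<Sum>(i, j)\<in>off_diag n. w {i, j}) = 2 * wt w (Kn_edges n)"
proof -
  let ?L = "{(i, j). i < j \<and> j < n}" and ?U = "{(i, j). j < i \<and> i < n}"
  have finL: "finite ?L" by (rule finite_subset[of _ "{..<n} \<times> {..<n}"]) auto
  have finU: "finite ?U" by (rule finite_subset[of _ "{..<n} \<times> {..<n}"]) auto
  have "inj_on (\<lambda>(i, j). {i, j}) ?L" by (auto simp: inj_on_def doubleton_eq_iff)
  moreover have "(\<lambda>(i, j). {i, j}) ` ?L = Kn_edges n"
  proof (intro set_eqI iffI)
    fix e assume "e \<in> Kn_edges n"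
    then obtain u v where uv: "u < n" "v < n" "u \<noteq> v" "e = {u, v}" by (auto simp: Kn_edges_def)
    then have "(min u v, max u v) \<in> ?L" "e = (\<lambda>(i, j). {i, j}) (min u v, max u v)"
      by (auto simp: min_def max_def)
    then show "e \<in> (\<lambda>(i, j). {i, j}) ` ?L" by blast
  qed (auto simp: Kn_edges_def, metis less_trans nat_neq_iff)
  ultimately have L: "wt w (Kn_edges n) = (\<Sum>(i, j)\<in>?L. w {i, j})"
    unfolding wt_def by (metis (no_types, lifting) sum.reindex_cong case_prod_beta')
  have U: "(\<Sum>(i, j)\<in>?U. w {i, j}) = (\<Sum>(i, j)\<in>?L. w {i, j})"
    by (rule sum.reindex_bij_witness[of _ prod.swap prod.swap]) (auto simp: insert_commute)
  have "off_diag n = ?L \<union> ?U" by (auto simp: off_diag_def)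
  moreover have "?L \<inter> ?U = {}" by auto
  ultimately have "(\<Sum>(i, j)\<in>off_diag n. w {i, j}) = (\<Sum>(i, j)\<in>?L. w {i, j}) + (\<Sum>(i, j)\<in>?U. w {i, j})"
    by (simp only: sum.union_disjoint[OF finL finU])
  then show ?thesis using U L by simp
qed

lemma sum_off_diag_permute:
  fixes g :: "nat \<Rightarrow> nat \<Rightarrow> real"
  assumes "bij_betw \<sigma> {..<n} {..<n}"
  shows "(\<Sum>(i, j)\<in>off_diag n. g (\<sigma> i) (\<sigma> j)) = (\<Sum>(i, j)\<in>off_diag n. g i j)"
proof -
  have "bij_betw (map_prod \<sigma> \<sigma>) (off_diag n) (off_diag n)"
  proof (rule bij_betwI')
    fix p q assume "p \<in> off_diag n" "q \<in> off_diag n"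
    then show "(map_prod \<sigma> \<sigma> p = map_prod \<sigma> \<sigma> q) = (p = q)"
      using bij_betw_imp_inj_on[OF assms] by (auto simp: off_diag_def inj_on_def)
  next
    fix p assume "p \<in> off_diag n"
    then show "map_prod \<sigma> \<sigma> p \<in> off_diag n"
      using bij_betw_imp_inj_on[OF assms] bij_betwE[OF assms] by (auto simp: off_diag_def inj_on_def)
  next
    fix q assume q: "q \<in> off_diag n"
    then obtain a b where "q = (a, b)" "a < n" "b < n" "a \<noteq> b" by (auto simp: off_diag_def)
    moreover obtain i where "i < n" "\<sigma> i = a" using \<open>a < n\<close> bij_betw_imp_surj_on[OF assms] by (metis imageE lessThan_iff)
    moreover obtain j where "j < n" "\<sigma> j = b" using \<open>b < n\<close> bij_betw_imp_surj_on[OF assms] by (metis imageE lessThan_iff)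
    ultimately show "\<exists>p\<in>off_diag n. q = map_prod \<sigma> \<sigma> p"
      by (intro bexI[of _ "(i, j)"]) (auto simp: off_diag_def)
  qed
  from sum.reindex_bij_betw[OF this, of "\<lambda>(i, j). g i j"] show ?thesis
    by (simp add: case_prod_beta)
qed

lemma sum_off_diag_fst_snd:
  fixes g :: "nat \<Rightarrow> real"
  shows "(\<Sum>(i, j)\<in>off_diag n. g i + g j) = 2 * (real n - 1) * (\<Sum>i<n. g i)"
proof -
  have od: "off_diag n = Sigma {..<n} (\<lambda>i. {..<n} - {i})" by (auto simp: off_diag_def)
  have "(\<Sum>(i, j)\<in>off_diag n. g i + g j) = (\<Sum>i<n. \<Sum>j\<in>{..<n} - {i}. g i + g j)"
    unfolding od by (subst sum.Sigma) auto
  also have "\<dots> = (\<Sum>i<n. (real n - 2) * g i + (\<Sum>j<n. g j))"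
    \<comment> \<open>The inner sum is \<open>(n - 1) * g i\<close> plus the full sum of
      \<open>g\<close> without \<open>g i\<close>.\<close>
    by (intro sum.cong refl) (auto simp: sum.distrib sum_diff1 algebra_simps of_nat_diff)
  also have "\<dots> = 2 * (real n - 1) * (\<Sum>i<n. g i)"
    unfolding sum.distrib sum_distrib_left[symmetric] by (simp add: algebra_simps)
  finally show ?thesis .
qed

section \<open>The 2-opt move\<close>

text \<open>The reversed segment starts at \<open>i + 1\<close>, so that the edges leaving positions
  \<open>i\<close> and \<open>j\<close> are the ones exchanged.\<close>

definition rev_seg :: "nat \<Rightarrow> nat \<Rightarrow> nat \<Rightarrow> nat" where
  "rev_seg i j k = (if i < k \<and> k \<le> j then i + 1 + j - k else k)"

definition two_opt :: "nat \<times> nat \<Rightarrow> nat \<Rightarrow> nat" where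
  "two_opt p = rev_seg (min (fst p) (snd p)) (max (fst p) (snd p))"

lemma rev_seg_invol: "rev_seg i j (rev_seg i j k) = k"
  by (auto simp: rev_seg_def)

lemma two_opt_comp: "two_opt p \<circ> two_opt p = id"
  by (auto simp: two_opt_def rev_seg_invol)

lemma two_opt_permutes:
  assumes "p \<in> off_diag n"
  shows "two_opt p permutes {..<n}"
proof (rule bij_imp_permutes)
  show "bij_betw (two_opt p) {..<n} {..<n}"
    using assms
    by (intro bij_betw_byWitness[where f' = "two_opt p"])
       (auto simp: two_opt_def rev_seg_invol off_diag_def, auto simp: rev_seg_def)
qed (use assms in \<open>auto simp: two_opt_def rev_seg_def off_diag_def\<close>)

text \<open>Edges outside the segment stay, those inside are traversed backwards, and only the two
  at its ends are replaced. The formula includes cyclically adjacent positions, where the removed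
  edges are added back.\<close>

lemma cyc_weight_rev_seg:
  assumes "i < j" "j < n"
  shows "cyc_weight n w (\<sigma> \<circ> rev_seg i j) = cyc_weight n w \<sigma>
     - w {\<sigma> i, \<sigma> ((i + 1) mod n)} - w {\<sigma> j, \<sigma> ((j + 1) mod n)}
     + w {\<sigma> i, \<sigma> j} + w {\<sigma> ((i + 1) mod n), \<sigma> ((j + 1) mod n)}"
proof -
  define e where "e \<tau> k = w {\<tau> k, \<tau> ((k + 1) mod n)}" for \<tau> :: "nat \<Rightarrow> nat" and k
  let ?r = "\<sigma> \<circ> rev_seg i j"
  let ?O = "{..<n} - {i..j}"
  have split: "cyc_weight n w \<tau> = (\<Sum>k\<in>?O. e \<tau> k) + e \<tau> i + (\<Sum>k\<in>{i<..<j}. e \<tau> k) + e \<tau> j" for \<tau>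
  proof -
    have "{i..j} \<subseteq> {..<n}" using assms by auto
    then have "cyc_weight n w \<tau> = (\<Sum>k\<in>?O. e \<tau> k) + (\<Sum>k\<in>{i..j}. e \<tau> k)"
      unfolding cyc_weight_def e_def by (intro sum.subset_diff) auto
    moreover have "{i..j} = insert i (insert j {i<..<j})" using assms by auto
    ultimately show ?thesis using assms by simp
  qed
  have "e ?r k = e \<sigma> k" if "k \<in> ?O" for k
  proof -
    have "rev_seg i j k = k" using that by (auto simp: rev_seg_def)
    \<comment> \<open>At the last position the successor wraps to 0, which is fixed because only
      positions above \<open>i\<close> move.\<close>
    moreover have "rev_seg i j ((k + 1) mod n) = (k + 1) mod n"
      using that assms by (cases "k + 1 = n") (auto simp: rev_seg_def)
    ultimately show ?thesis by (simp add: e_def)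
  qed
  then have 1: "(\<Sum>k\<in>?O. e ?r k) = (\<Sum>k\<in>?O. e \<sigma> k)" by (intro sum.cong) auto
  \<comment> \<open>The new edge at \<open>k\<close> is the old edge at \<open>i + j - k\<close>,
    traversed backwards.\<close>
  have 2: "(\<Sum>k\<in>{i<..<j}. e ?r k) = (\<Sum>k\<in>{i<..<j}. e \<sigma> k)"
  proof (rule sum.reindex_bij_witness[of _ "\<lambda>k. i + j - k" "\<lambda>k. i + j - k"])
    fix k assume k: "k \<in> {i<..<j}"
    then have "rev_seg i j k = (i + j - k + 1) mod n" "rev_seg i j ((k + 1) mod n) = i + j - k"
      using assms by (auto simp: rev_seg_def)
    then show "e \<sigma> (i + j - k) = e ?r k" by (simp add: e_def insert_commute)
  qed auto
  have 3: "e ?r i = w {\<sigma> i, \<sigma> j}" using assms by (auto simp: e_def rev_seg_def)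
  have "rev_seg i j j = (i + 1) mod n" using assms by (simp add: rev_seg_def)
  moreover have "rev_seg i j ((j + 1) mod n) = (j + 1) mod n"
    using assms by (cases "j + 1 = n") (auto simp: rev_seg_def)
  ultimately have 4: "e ?r j = w {\<sigma> ((i + 1) mod n), \<sigma> ((j + 1) mod n)}" by (simp add: e_def)
  show ?thesis unfolding split[of ?r] split[of \<sigma>] 1 2 3 4 by (simp add: e_def)
qed

lemma cyc_weight_two_opt:
  assumes "(i, j) \<in> off_diag n"
  shows "cyc_weight n w \<sigma> - cyc_weight n w (\<sigma> \<circ> two_opt (i, j)) =
     (w {\<sigma> i, \<sigma> ((i + 1) mod n)} + w {\<sigma> j, \<sigma> ((j + 1) mod n)})
     - (w {\<sigma> i, \<sigma> j} + w {\<sigma> ((i + 1) mod n), \<sigma> ((j + 1) mod n)})"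
proof (cases "i < j")
  case True
  then show ?thesis using assms cyc_weight_rev_seg[of i j n w \<sigma>]
    by (simp add: two_opt_def off_diag_def)
next
  case False
  then have "j < i" using assms by (auto simp: off_diag_def)
  then show ?thesis using assms cyc_weight_rev_seg[of j i n w \<sigma>]
    by (simp add: two_opt_def off_diag_def insert_commute)
qed

lemma bij_betw_succ_mod:
  fixes n :: nat
  assumes "0 < n"
  shows "bij_betw (\<lambda>i. (i + 1) mod n) {..<n} {..<n}"
proof -
  have "inj_on (\<lambda>i. (i + 1) mod n) {..<n}"
  proof (rule inj_onI)
    fix i j :: nat assume "i \<in> {..<n}" "j \<in> {..<n}" "(i + 1) mod n = (j + 1) mod n"
    then show "i = j" using succ_mod_eq[of i n] succ_mod_eq[of j n] by (simp split: if_splits)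
  qed
  moreover have "(\<lambda>i. (i + 1) mod n) ` {..<n} \<subseteq> {..<n}" using assms by auto
  ultimately show ?thesis
    by (simp add: bij_betw_def endo_inj_surj)
qed

section \<open>Drift and squared change of the weight, summed over all 2-opt moves\<close>

context
  fixes n :: nat and w :: "nat set \<Rightarrow> real" and d :: real and \<sigma> :: "nat \<Rightarrow> nat"
  assumes n: "3 \<le> n" and perm: "\<sigma> permutes {..<n}"
    and zo: "zero_one_instance n w" and dens: "wt w (Kn_edges n) = d * real (n choose 2)"
begin

text \<open>Each position occurs in \<open>2 * (n - 1)\<close> of the ordered pairs.\<close>

lemma sum_removed:
  "(\<Sum>(i, j)\<in>off_diag n. w {\<sigma> i, \<sigma> ((i + 1) mod n)} + w {\<sigma> j, \<sigma> ((j + 1) mod n)})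
     = 2 * (real n - 1) * cyc_weight n w \<sigma>"
  unfolding cyc_weight_def by (rule sum_off_diag_fst_snd)

text \<open>As \<open>(i, j)\<close> varies, the two added pairs each run through all ordered pairs
  of distinct vertices, so every edge of the complete graph is added four times.\<close>

lemma sum_added:
  "(\<Sum>(i, j)\<in>off_diag n. w {\<sigma> i, \<sigma> j} + w {\<sigma> ((i + 1) mod n), \<sigma> ((j + 1) mod n)})
     = 2 * (real n - 1) * (d * real n)"
proof -
  have b: "bij_betw \<sigma> {..<n} {..<n}" using permutes_imp_bij[OF perm] .
  have b': "bij_betw (\<lambda>i. \<sigma> ((i + 1) mod n)) {..<n} {..<n}"
    using bij_betw_trans[OF bij_betw_succ_mod b] n by (simp add: comp_def)
  have "(\<Sum>(i, j)\<in>off_diag n. w {\<sigma> i, \<sigma> j} + w {\<sigma> ((i + 1) mod n), \<sigma> ((j + 1) mod n)})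
      = (\<Sum>(i, j)\<in>off_diag n. w {\<sigma> i, \<sigma> j}) + (\<Sum>(i, j)\<in>off_diag n. w {\<sigma> ((i + 1) mod n), \<sigma> ((j + 1) mod n)})"
    by (simp add: case_prod_beta sum.distrib)
  also have "\<dots> = 4 * wt w (Kn_edges n)"
    using sum_off_diag_permute[OF b, of "\<lambda>i j. w {i, j}"] sum_off_diag_permute[OF b', of "\<lambda>i j. w {i, j}"]
      sum_off_diag_edges[of w n] by simp
  also have "\<dots> = 2 * (real n - 1) * (d * real n)"
    unfolding dens using n by (simp add: choose_two real_of_nat_div of_nat_diff)
  finally show ?thesis .
qed

lemma cyc_weight_drift:
  "(\<Sum>p\<in>off_diag n. cyc_weight n w \<sigma> - cyc_weight n w (\<sigma> \<circ> two_opt p))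
     = 2 * (real n - 1) * (cyc_weight n w \<sigma> - d * real n)"
proof -
  have "(\<Sum>p\<in>off_diag n. cyc_weight n w \<sigma> - cyc_weight n w (\<sigma> \<circ> two_opt p))
     = (\<Sum>(i, j)\<in>off_diag n. (w {\<sigma> i, \<sigma> ((i + 1) mod n)} + w {\<sigma> j, \<sigma> ((j + 1) mod n)})
     - (w {\<sigma> i, \<sigma> j} + w {\<sigma> ((i + 1) mod n), \<sigma> ((j + 1) mod n)}))"
    by (intro sum.cong refl) (auto simp: cyc_weight_two_opt)
  also have "\<dots> = 2 * (real n - 1) * (cyc_weight n w \<sigma> - d * real n)"
    using sum_removed sum_added by (simp add: case_prod_beta sum_subtractf algebra_simps)
  finally show ?thesis .
qed

text \<open>The change is bounded by 2 and also by removed plus added weight. The product of these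
  bounds is linear in the weights, so the sums already computed for the drift apply.\<close>

lemma cyc_weight_quad:
  "(\<Sum>p\<in>off_diag n. (cyc_weight n w \<sigma> - cyc_weight n w (\<sigma> \<circ> two_opt p))\<^sup>2)
     \<le> 2 * (2 * (real n - 1)) * (cyc_weight n w \<sigma> + d * real n)"
proof -
  have w01: "0 \<le> w {\<sigma> a, \<sigma> b} \<and> w {\<sigma> a, \<sigma> b} \<le> 1" if "a < n" "b < n" "a \<noteq> b" for a b
  proof -
    have "{\<sigma> a, \<sigma> b} \<in> Kn_edges n"
      using that permutes_in_image[OF perm, of a] permutes_in_image[OF perm, of b]
        inj_eq[OF permutes_inj[OF perm], of a b]
      unfolding Kn_edges_def by blast
    then show ?thesis using zo unfolding zero_one_instance_def by fastforce
  qed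
  have sq: "(x + y - (z + u))\<^sup>2 \<le> 2 * ((x + y) + (z + u))"
    if "0 \<le> x \<and> x \<le> 1" "0 \<le> y \<and> y \<le> 1" "0 \<le> z \<and> z \<le> 1" "0 \<le> u \<and> u \<le> 1" for x y z u :: real
  proof -
    have "\<bar>x + y - (z + u)\<bar> * \<bar>x + y - (z + u)\<bar> \<le> 2 * ((x + y) + (z + u))"
      using that by (intro mult_mono) auto
    then show ?thesis by (simp add: power2_eq_square)
  qed
  have "(\<Sum>p\<in>off_diag n. (cyc_weight n w \<sigma> - cyc_weight n w (\<sigma> \<circ> two_opt p))\<^sup>2)
     \<le> (\<Sum>(i, j)\<in>off_diag n. 2 * ((w {\<sigma> i, \<sigma> ((i + 1) mod n)} + w {\<sigma> j, \<sigma> ((j + 1) mod n)})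
     + (w {\<sigma> i, \<sigma> j} + w {\<sigma> ((i + 1) mod n), \<sigma> ((j + 1) mod n)})))"
  proof (rule sum_mono, safe)
    fix i j assume ij: "(i, j) \<in> off_diag n"
    then have "i < n" "j < n" "i \<noteq> j" by (auto simp: off_diag_def)
    \<comment> \<open>Weights are known to be 0 or 1 only on genuine edges, so all four pairs need
      distinct endpoints.\<close>
    moreover have "k \<noteq> (k + 1) mod n" "(k + 1) mod n < n" if "k < n" for k
      using that n by (cases "k + 1 = n"; auto)+
    moreover have "(i + 1) mod n \<noteq> (j + 1) mod n"
      using inj_on_eq_iff[OF bij_betw_imp_inj_on[OF bij_betw_succ_mod[of n]], of i j] calculation(1-3) n
      by simp
    ultimately show "(cyc_weight n w \<sigma> - cyc_weight n w (\<sigma> \<circ> two_opt (i, j)))\<^sup>2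
       \<le> 2 * ((w {\<sigma> i, \<sigma> ((i + 1) mod n)} + w {\<sigma> j, \<sigma> ((j + 1) mod n)})
     + (w {\<sigma> i, \<sigma> j} + w {\<sigma> ((i + 1) mod n), \<sigma> ((j + 1) mod n)}))"
      unfolding cyc_weight_two_opt[OF ij] by (intro sq w01) auto
  qed
  also have "\<dots> = 2 * (2 * (real n - 1)) * (cyc_weight n w \<sigma> + d * real n)"
    using sum_removed sum_added
    by (simp add: case_prod_beta sum.distrib algebra_simps flip: sum_distrib_left)
  finally show ?thesis .
qed

end

section \<open>Tail bounds for the weight of a random Hamilton cycle\<close>

lemma involution_family_cyc_weight:
  assumes "3 \<le> n" "zero_one_instance n w" "wt w (Kn_edges n) = d * real (n choose 2)"
    and "0 \<le> d" and s: "s = 1 \<or> s = -1"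
  shows "involution_family {\<sigma>. \<sigma> permutes {..<n}} (off_diag n) (\<lambda>p \<sigma>. \<sigma> \<circ> two_opt p)
    (\<lambda>\<sigma>. s * (cyc_weight n w \<sigma> - d * real n)) (2 * (real n - 1)) s (2 * d * real n)"
proof
  show "finite {\<sigma>. \<sigma> permutes {..<n}}" by (simp add: finite_permutations)
next
  fix p \<sigma> assume "p \<in> off_diag n" "\<sigma> \<in> {\<sigma>. \<sigma> permutes {..<n}}"
  then show "\<sigma> \<circ> two_opt p \<in> {\<sigma>. \<sigma> permutes {..<n}}"
    by (auto intro: permutes_compose two_opt_permutes)
next
  fix p :: "nat \<times> nat" and \<sigma> :: "nat \<Rightarrow> nat"
  show "\<sigma> \<circ> two_opt p \<circ> two_opt p = \<sigma>" by (simp add: o_assoc[symmetric] two_opt_comp)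
next
  fix \<sigma> assume "\<sigma> \<in> {\<sigma>. \<sigma> permutes {..<n}}"
  then have p: "\<sigma> permutes {..<n}" by simp
  show "(\<Sum>p\<in>off_diag n. s * (cyc_weight n w \<sigma> - d * real n) - s * (cyc_weight n w (\<sigma> \<circ> two_opt p) - d * real n))
      = 2 * (real n - 1) * (s * (cyc_weight n w \<sigma> - d * real n))"
    using cyc_weight_drift[OF assms(1) p assms(2,3)]
    by (simp flip: sum_distrib_left right_diff_distrib)
  have sq: "(s * x - s * y)\<^sup>2 = (x - y)\<^sup>2" for x y
    using s by (auto simp: power2_eq_square algebra_simps)
  \<comment> \<open>With \<open>s * s = 1\<close> and \<open>K = 2 * d * n\<close>, the expression
    \<open>s * f + K\<close> becomes the weight plus \<open>d * n\<close>, as in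
    \<open>cyc_weight_quad\<close>.\<close>
  have ss: "s * (s * (cyc_weight n w \<sigma> - d * real n)) = cyc_weight n w \<sigma> - d * real n"
    using s by auto
  show "(\<Sum>p\<in>off_diag n. (s * (cyc_weight n w \<sigma> - d * real n) - s * (cyc_weight n w (\<sigma> \<circ> two_opt p) - d * real n))\<^sup>2)
      \<le> 2 * (2 * (real n - 1)) * (s * (s * (cyc_weight n w \<sigma> - d * real n)) + 2 * d * real n)"
    unfolding sq ss using cyc_weight_quad[OF assms(1) p assms(2,3)] by (simp add: add.commute)
qed (use assms in auto)

lemma cyc_weight_tail:
  assumes "3 \<le> n" "zero_one_instance n w" "wt w (Kn_edges n) = d * real (n choose 2)"
    and "0 \<le> d" "s = 1 \<or> s = -1" "0 < t" "8 * L \<le> t" "16 * d * real n * L \<le> t\<^sup>2"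
  shows "real (card {\<sigma>. \<sigma> permutes {..<n} \<and> t \<le> s * (cyc_weight n w \<sigma> - d * real n)})
    \<le> real (card {\<sigma>. \<sigma> permutes {..<n}}) * exp (- L)"
  using involution_family.tail_bound[OF involution_family_cyc_weight[OF assms(1-5)] assms(6,7)] assms(8)
  by simp

text \<open>Passing to \<open>1 - w\<close> exchanges \<open>d\<close> with \<open>1 - d\<close> and
  negates the deviation of a cycle weight from its mean, so a lower tail becomes an upper tail with
  variance scale \<open>(1 - d) * n\<close>.\<close>

lemma complement_instance:
  assumes "zero_one_instance n w" "wt w (Kn_edges n) = d * real (n choose 2)" "3 \<le> n"
  shows "zero_one_instance n (\<lambda>e. 1 - w e)"
    and "wt (\<lambda>e. 1 - w e) (Kn_edges n) = (1 - d) * real (n choose 2)"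
    and "cyc_weight n (\<lambda>e. 1 - w e) \<sigma> = real n - cyc_weight n w \<sigma>"
proof -
  show "zero_one_instance n (\<lambda>e. 1 - w e)"
    using assms(1) unfolding zero_one_instance_def by auto
  \<comment> \<open>Writing 1 as \<open>1/2 + 1/2\<close> lets \<open>sum_off_diag_fst_snd\<close>
    count the edges.\<close>
  have "2 * wt (\<lambda>_. 1) (Kn_edges n) = (\<Sum>(i, j)\<in>off_diag n. 1/2 + 1/2)"
    using sum_off_diag_edges[of "\<lambda>_. 1" n] by simp
  also have "\<dots> = (real n - 1) * real n"
    by (subst sum_off_diag_fst_snd) simp
  finally have "wt (\<lambda>_. 1) (Kn_edges n) = real (n choose 2)"
    using assms(3) by (simp add: choose_two real_of_nat_div of_nat_diff mult.commute)
  then show "wt (\<lambda>e. 1 - w e) (Kn_edges n) = (1 - d) * real (n choose 2)"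
    using assms(2) by (simp add: wt_def sum_subtractf algebra_simps)
  show "cyc_weight n (\<lambda>e. 1 - w e) \<sigma> = real n - cyc_weight n w \<sigma>"
    by (simp add: cyc_weight_def sum_subtractf)
qed

text \<open>The two summands of \<open>m_eps\<close> dominate the two scales of the Bernstein bound:
  the linear scale \<open>L\<close> and the Gaussian scale \<open>S\<close>, the square root of
  \<open>d * n * L\<close>.\<close>

lemma m_eps_deviation:
  assumes "0 \<le> d" "d \<le> 1" "0 < \<epsilon>" "exp (1 / \<epsilon>) < real n" "6 < n"
  defines "t \<equiv> (1 - 1 / (real n - 2)) * m_eps \<epsilon> n d - 1"
  shows "0 < t" "8 * (\<epsilon> * ln (real n)) \<le> t" "16 * d * real n * (\<epsilon> * ln (real n)) \<le> t\<^sup>2"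
proof -
  define L where "L = \<epsilon> * ln (real n)"
  define S where "S = sqrt (d * real n * L)"
  have "1 / \<epsilon> < ln (real n)" using assms by (metis exp_gt_zero exp_less_cancel_iff exp_ln less_trans)
  then have L1: "1 < L" using assms by (simp add: L_def field_simps)
  then have ln0: "0 \<le> ln (real n)" using assms by simp
  \<comment> \<open>As \<open>d \<le> 1\<close>, the fourth root in \<open>m_eps\<close> is at least
    the square root occurring in \<open>S\<close>.\<close>
  have "sqrt d = d powr (1/2)" using assms by (simp add: powr_half_sqrt)
  also have "\<dots> \<le> d powr (1/4)" using assms by (intro powr_mono') auto
  finally have "sqrt d \<le> d powr (1/4)" .
  then have "sqrt \<epsilon> * sqrt d * sqrt (real n * ln (real n)) \<le> sqrt \<epsilon> * d powr (1/4) * sqrt (real n * ln (real n))"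
    using assms ln0 by (intro mult_right_mono mult_left_mono) auto
  moreover have "S = sqrt \<epsilon> * sqrt d * sqrt (real n * ln (real n))"
    unfolding S_def L_def by (simp add: mult_ac flip: real_sqrt_mult)
  moreover have "L \<le> (\<epsilon> + sqrt \<epsilon>) * ln (real n)"
    unfolding L_def using assms ln0 by (intro mult_right_mono) auto
  ultimately have "40 * L + 40 * S \<le> 40 * ((\<epsilon> + sqrt \<epsilon>) * ln (real n))
      + 40 * (sqrt \<epsilon> * d powr (1/4) * sqrt (real n * ln (real n)))" by linarith
  then have m: "40 * L + 40 * S \<le> m_eps \<epsilon> n d" by (simp only: m_eps_def mult.assoc)
  have S0: "0 \<le> S" using assms L1 by (simp add: S_def)
  have "1 / (real n - 2) \<le> 1/5" using assms(5) by (simp add: field_simps)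
  then have "4/5 * m_eps \<epsilon> n d \<le> (1 - 1 / (real n - 2)) * m_eps \<epsilon> n d"
    using m S0 L1 by (intro mult_right_mono) auto
  \<comment> \<open>Here 32 is 4/5 of 40, and one unit of \<open>L > 1\<close> pays for the
    subtracted 1.\<close>
  then have t: "31 * L + 32 * S \<le> t" unfolding t_def using m L1 by linarith
  show "0 < t" "8 * (\<epsilon> * ln (real n)) \<le> t" using t L1 S0 by (auto simp flip: L_def)
  have "16 * d * real n * L = (4 * S)\<^sup>2"
    using assms L1 by (simp add: S_def power_mult_distrib)
  also have "\<dots> \<le> t\<^sup>2" using t S0 L1 by (intro power_mono) auto
  finally show "16 * d * real n * (\<epsilon> * ln (real n)) \<le> t\<^sup>2" by (simp add: L_def)
qed

text \<open>The second conjunct is the domination ratio: the proportion of tours at least as heavy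
  as \<open>Hstar\<close>. It follows from the first because the lighter-or-equal and
  heavier-or-equal tours together cover all tours.\<close>

theorem theorem5p4:
  fixes n :: nat and w :: "nat set \<Rightarrow> real" and d \<epsilon> :: real
    and Mstar Hstar :: "nat set set"
  assumes reg: "regular_instance n w d \<epsilon>"
    and Mopt: "optimal_matching n Mstar"
    and Mmin: "\<forall>M. optimal_matching n M \<longrightarrow> wt w Mstar \<le> wt w M"
    and Hham: "Hstar \<in> ham_cycles n"
    and Hbound: "wt w Hstar \<le> (1 - 1 / (real n - 2)) * wt w Mstar
                   + 1 / (real n - 2) * wt w (Kn_edges n) + (if odd n then 1 else 0)"
  shows "real (card {H \<in> ham_cycles n. wt w H \<le> wt w Hstar}) / real (card (ham_cycles n))
           \<le> 2 * real n powr (- \<epsilon>)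
       \<and> real (card {H \<in> ham_cycles n. wt w H \<ge> wt w Hstar}) / real (card (ham_cycles n))
           \<ge> 1 - 2 * real n powr (- \<epsilon>)"
proof -
  let ?X = "{\<sigma>. \<sigma> permutes {..<n}}"
  let ?L = "\<epsilon> * ln (real n)"
  have d: "0 \<le> d" "d \<le> 1" and eps: "0 < \<epsilon>" and n: "6 < n" "exp (1 / \<epsilon>) < real n"
    and zo: "zero_one_instance n w" and dens: "wt w (Kn_edges n) = d * real (n choose 2)"
    using reg by (auto simp: regular_instance_def)
  have n3: "3 \<le> n" using n by simp
  obtain M \<delta> where M: "optimal_matching n M" and \<delta>: "\<delta> = d \<or> \<delta> = 1 - d"
    and wM: "wt w M \<le> d * real n / 2 - m_eps \<epsilon> n \<delta>"
    using reg unfolding regular_instance_def by blast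
  define t where "t = (1 - 1 / (real n - 2)) * m_eps \<epsilon> n \<delta> - 1"
  have \<delta>01: "0 \<le> \<delta>" "\<delta> \<le> 1" using \<delta> d by auto
  note t = m_eps_deviation[OF \<delta>01 eps n(2,1), folded t_def]
  have Hs: "wt w Hstar \<le> d * real n - t"
  proof -
    have "wt w Mstar \<le> d * real n / 2 - m_eps \<epsilon> n \<delta>" using Mmin M wM by fastforce
    then have "(1 - 1 / (real n - 2)) * wt w Mstar \<le> (1 - 1 / (real n - 2)) * (d * real n / 2 - m_eps \<epsilon> n \<delta>)"
      using n by (intro mult_left_mono) (auto simp: field_simps)
    moreover have "wt w Hstar \<le> (1 - 1 / (real n - 2)) * wt w Mstar + 1 / (real n - 2) * wt w (Kn_edges n) + 1"
      by (rule order_trans[OF Hbound]) simp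
    moreover have "wt w (Kn_edges n) = d * (real n * (real n - 1) / 2)"
      using n by (simp add: dens choose_two real_of_nat_div of_nat_diff)
    ultimately have "wt w Hstar \<le> (1 - 1 / (real n - 2)) * (d * real n / 2 - m_eps \<epsilon> n \<delta>)
        + 1 / (real n - 2) * (d * (real n * (real n - 1) / 2)) + 1"
      by simp
    \<comment> \<open>The matching and the complete graph contribute \<open>d * n / 2\<close> with
      factors \<open>(n - 3) / (n - 2)\<close> and \<open>(n - 1) / (n - 2)\<close>, which add up to
      2.\<close>
    also have "\<dots> = d * real n - t"
      using n unfolding t_def by (simp add: divide_simps) (simp add: algebra_simps)
    finally show ?thesis .
  qed
  \<comment> \<open>For \<open>\<delta> = d\<close> this is the lower tail for \<open>w\<close>,
    with sign -1. For \<open>\<delta> = 1 - d\<close> it is the upper tail for the complementary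
    weights, whose density is \<delta>.\<close>
  have tail: "real (card {\<sigma>. \<sigma> permutes {..<n} \<and> t \<le> d * real n - cyc_weight n w \<sigma>}) \<le> real (card ?X) * exp (- ?L)"
    using \<delta>
  proof
    assume "\<delta> = d"
    then show ?thesis using cyc_weight_tail[OF n3 zo dens d(1), of "-1" t ?L] t by simp
  next
    assume "\<delta> = 1 - d"
    note compl = complement_instance[OF zo dens n3, folded \<open>\<delta> = 1 - d\<close>]
    have "1 * (cyc_weight n (\<lambda>e. 1 - w e) \<sigma> - \<delta> * real n) = d * real n - cyc_weight n w \<sigma>" for \<sigma>
      unfolding compl(3) \<open>\<delta> = 1 - d\<close> by (simp add: algebra_simps)
    then show ?thesis
      using cyc_weight_tail[OF n3 compl(1,2) \<delta>01(1) disjI1[OF refl] t] by (simp only:)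
  qed
  have "card {\<sigma>. \<sigma> permutes {..<n} \<and> wt w (cyc n \<sigma>) \<le> wt w Hstar}
      \<le> card {\<sigma>. \<sigma> permutes {..<n} \<and> t \<le> d * real n - cyc_weight n w \<sigma>}"
  proof (rule card_mono)
    show "finite {\<sigma>. \<sigma> permutes {..<n} \<and> t \<le> d * real n - cyc_weight n w \<sigma>}"
      by (rule finite_subset[OF _ finite_permutations[of "{..<n}"]]) auto
  qed (use Hs in \<open>auto simp: wt_cyc[OF _ n3]\<close>)
  with tail have "real (card {\<sigma>. \<sigma> permutes {..<n} \<and> wt w (cyc n \<sigma>) \<le> wt w Hstar}) \<le> real (card ?X) * exp (- ?L)"
    by linarith
  moreover have "0 < card ?X" by (simp add: card_permutations[OF refl])
  ultimately have "real (card {H \<in> ham_cycles n. wt w H \<le> wt w Hstar}) / real (card (ham_cycles n)) \<le> exp (- ?L)"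
    unfolding ham_cycles_ratio_eq by (simp add: field_simps)
  also have "exp (- ?L) = real n powr (- \<epsilon>)" using n by (simp add: powr_def)
  also have "\<dots> \<le> 2 * real n powr (- \<epsilon>)" by simp
  finally have le: "real (card {H \<in> ham_cycles n. wt w H \<le> wt w Hstar}) / real (card (ham_cycles n))
           \<le> 2 * real n powr (- \<epsilon>)" .
  have fin: "finite (ham_cycles n)" by (simp add: ham_cycles_eq finite_permutations)
  have pos: "0 < card (ham_cycles n)" using Hham fin by (auto simp: card_gt_0_iff)
  have "card (ham_cycles n) = card ({H \<in> ham_cycles n. wt w H \<le> wt w Hstar} \<union> {H \<in> ham_cycles n. wt w H \<ge> wt w Hstar})"
    by (intro arg_cong[of _ _ card]) auto
  also have "\<dots> \<le> card {H \<in> ham_cycles n. wt w H \<le> wt w Hstar} + card {H \<in> ham_cycles n. wt w H \<ge> wt w Hstar}"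
    by (rule card_Un_le)
  finally have "real (card (ham_cycles n)) \<le> real (card {H \<in> ham_cycles n. wt w H \<le> wt w Hstar})
      + real (card {H \<in> ham_cycles n. wt w H \<ge> wt w Hstar})" by linarith
  then have "1 \<le> real (card {H \<in> ham_cycles n. wt w H \<le> wt w Hstar}) / real (card (ham_cycles n))
      + real (card {H \<in> ham_cycles n. wt w H \<ge> wt w Hstar}) / real (card (ham_cycles n))"
    using pos by (simp flip: add_divide_distrib)
  with le show ?thesis by linarith
qed

end
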